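(* Let $a\in\mathbb R$ and let $f:[a,+\infty)\to\mathbb R$ be continuous on $[a,+\infty)$ and differentiable on $(a,+\infty)$, with $f(a)<0$, $\lim_{\xi\to+\infty}f(\xi)>0$ (the limit possibly being $+\infty$), and $f'(\xi)>0$ for all $\xi\in(a,+\infty)$. Suppose that one of the following two conditions is satisfied: (1) $f'$ is monotone on $(a,+\infty)$; (2) there exists $\xi_{in}\in(a,+\infty)$ such that $f'$ is monotonically decreasing on $(a,\xi_{in}]$ and monotonically increasing on $[\xi_{in},+\infty)$. Then $f$ has a unique root $\xi_*\in(a,+\infty)$. Moreover, for the Newton--Raphson iteration $\xi_{n+1}=\xi_n-f(\xi_n)/f'(\xi_n)$, $n\ge0$, with any initial value $\xi_0\in(a,\xi_*]$, the iteration sequence satisfies $\{\xi_n\}_{n\ge0}\subseteq(a,+\infty)$ and $\lim_{n\to+\infty}\xi_n=\xi_*$.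
   Context: "Monotone", "monotonically decreasing" and "monotonically increasing" are meant in the non-strict sense. *)

theory Defs
  imports Complex_Main "HOL-Library.Extended_Real"
begin

end

theory Submission
  imports Defs
begin

text \<open>
  The mean value theorem on the interval between an iterate and the root \<open>s\<close> decides on which side of
  \<open>s\<close> the next iterate lies. In every case \<open>f'\<close> is decreasing to the left of \<open>s\<close> or increasing to the
  right of \<open>s\<close>. In the first case the iterates increase and stay below \<open>s\<close>. In the second case they
  increase as long as they lie below \<open>s\<close>, and once beyond \<open>s\<close> they decrease and stay above \<open>s\<close>. So
  the sequence is eventually monotone and bounded. Moreover \<open>f'\<close> is bounded on compact intervals by
  its values at the end points, hence \<open>f (\<xi> n) = (\<xi> n - \<xi> (Suc n)) * f' (\<xi> n)\<close> tends to \<open>0\<close> and the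
  limit is a root.
\<close>

locale newton_root =
  fixes a s :: real and f f' :: "real \<Rightarrow> real"
  assumes deriv: "\<And>x. a < x \<Longrightarrow> (f has_real_derivative f' x) (at x)"
    and deriv_pos: "\<And>x. a < x \<Longrightarrow> f' x > 0"
    and root_gt: "a < s"
    and root: "f s = 0"
    and deriv_le_max: "\<And>u x v. \<lbrakk>a < u; u \<le> x; x \<le> v\<rbrakk> \<Longrightarrow> f' x \<le> max (f' u) (f' v)"
begin

lemma strict_increasing:
  assumes "a < x" "x < y"
  shows "f x < f y"
proof (rule DERIV_pos_imp_increasing[OF assms(2)])
  fix z assume "x \<le> z" "z \<le> y"
  with assms(1) have "a < z" by simp
  with deriv deriv_pos show "\<exists>d. (f has_real_derivative d) (at z) \<and> d > 0" by blast
qed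

lemma root_unique:
  assumes "a < x" "f x = 0"
  shows "x = s"
  using strict_increasing[of x s] strict_increasing[of s x] assms root_gt root
  by (cases x s rule: linorder_cases) auto

lemma nonpos_left:
  assumes "a < x" "x \<le> s"
  shows "f x \<le> 0"
  using strict_increasing[of x s] assms root by (cases "x = s") auto

lemma nonneg_right:
  assumes "s \<le> x"
  shows "f x \<ge> 0"
  using strict_increasing[of s x] assms root root_gt by (cases "x = s") auto

lemma step_ge_left:
  assumes "a < x" "x \<le> s"
  shows "x \<le> x - f x / f' x"
  using nonpos_left[OF assms] deriv_pos[OF assms(1)] by (simp add: divide_nonpos_pos)

lemma step_le_right:
  assumes "s \<le> x"
  shows "x - f x / f' x \<le> x"
  using nonneg_right[OF assms] deriv_pos[of x] assms root_gt by simp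

text \<open>The chord from the graph point at \<open>x\<close> to the root has slope
  \<open>f' z\<close> for some \<open>z\<close> beyond \<open>x\<close>. With \<open>f'\<close>
  decreasing, the tangent at \<open>x\<close> is at least as steep and so meets the axis no later
  than \<open>s\<close>.\<close>

lemma step_le_root:
  assumes "antimono_on {a<..s} f'" "a < x" "x \<le> s"
  shows "x - f x / f' x \<le> s"
proof (cases "x = s")
  case False
  with assms have "x < s" by simp
  then obtain z where z: "x < z" "z < s" "f s - f x = (s - x) * f' z"
    using MVT2[of x s f f'] deriv assms(2) by force
  have "f' z \<le> f' x" using assms z by (auto simp: monotone_on_def)
  then have "- f x \<le> (s - x) * f' x" using z root \<open>x < s\<close> by simp
  then have "- f x / f' x \<le> s - x" using deriv_pos[OF assms(2)] by (simp only: pos_divide_le_eq)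
  then show ?thesis by simp
qed (simp add: root)

text \<open>Mirror image: the chord slope is now attained to the left of \<open>x\<close>, so for
  increasing \<open>f'\<close> the tangent at \<open>x\<close> is at least as steep as the chord and
  cannot cut the axis before \<open>s\<close>.\<close>

lemma step_ge_root:
  assumes "mono_on {s..} f'" "s \<le> x"
  shows "s \<le> x - f x / f' x"
proof (cases "x = s")
  case False
  with assms have "s < x" by simp
  then obtain z where z: "s < z" "z < x" "f x - f s = (x - s) * f' z"
    using MVT2[of s x f f'] deriv root_gt by force
  have "f' z \<le> f' x" using assms z by (auto simp: monotone_on_def)
  then have "f x \<le> (x - s) * f' x" using z root \<open>s < x\<close> by simp
  then have "f x / f' x \<le> x - s"
    using deriv_pos[of x] root_gt \<open>s < x\<close> by (simp add: pos_divide_le_eq)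
  then show ?thesis by simp
qed (simp add: root)

lemma bounded_monotone_tendsto:
  assumes step: "\<And>n. \<xi> (Suc n) = \<xi> n - f (\<xi> n) / f' (\<xi> n)"
    and "a < u" and bnd: "\<And>n. u \<le> \<xi> n" "\<And>n. \<xi> n \<le> v" and "monoseq \<xi>"
  shows "\<xi> \<longlonglongrightarrow> s"
proof -
  have "norm (\<xi> n) \<le> max \<bar>u\<bar> \<bar>v\<bar>" for n
    unfolding real_norm_def using bnd(1)[of n] bnd(2)[of n] by linarith
  then have "Bseq \<xi>" by (rule BseqI')
  with \<open>monoseq \<xi>\<close> obtain l where l: "\<xi> \<longlonglongrightarrow> l"
    using Bseq_monoseq_convergent unfolding convergent_def by blast
  \<comment> \<open>A bound \<open>u\<close> strictly above \<open>a\<close> keeps the limit in the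
    open half-line, where \<open>f\<close> is known to be continuous.\<close>
  have "a < l" using LIMSEQ_le_const[OF l] bnd(1) \<open>a < u\<close> by (meson less_le_trans)
  have "(\<lambda>n. \<xi> n - \<xi> (Suc n)) \<longlonglongrightarrow> l - l" by (intro tendsto_intros l LIMSEQ_Suc)
  then have diff: "(\<lambda>n. \<xi> n - \<xi> (Suc n)) \<longlonglongrightarrow> 0" by simp
  \<comment> \<open>Continuity of \<open>f'\<close> is not among the locale assumptions, so the
    recursion is not passed to the limit directly; the residual is estimated by the step length
    instead.\<close>
  have "(\<lambda>n. f (\<xi> n)) \<longlonglongrightarrow> 0"
  proof (rule tendsto_0_le[OF diff, where K = "max (f' u) (f' v)"], intro always_eventually allI)
    fix n
    have pos: "f' (\<xi> n) > 0" using deriv_pos bnd(1)[of n] \<open>a < u\<close> by simp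
    then have "f (\<xi> n) = (\<xi> n - \<xi> (Suc n)) * f' (\<xi> n)" by (simp add: step)
    then have "norm (f (\<xi> n)) = norm (\<xi> n - \<xi> (Suc n)) * f' (\<xi> n)" using pos by (simp add: abs_mult)
    also have "\<dots> \<le> norm (\<xi> n - \<xi> (Suc n)) * max (f' u) (f' v)"
      by (intro mult_left_mono deriv_le_max \<open>a < u\<close> bnd) simp
    finally show "norm (f (\<xi> n)) \<le> norm (\<xi> n - \<xi> (Suc n)) * max (f' u) (f' v)" .
  qed
  moreover have "(\<lambda>n. f (\<xi> n)) \<longlonglongrightarrow> f l"
    using isCont_tendsto_compose[OF DERIV_isCont[OF deriv[OF \<open>a < l\<close>]] l] .
  ultimately have "f l = 0" by (simp add: LIMSEQ_unique)
  with root_unique \<open>a < l\<close> l show ?thesis by blast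
qed

lemma tendsto_from_left:
  assumes step: "\<And>n. \<xi> (Suc n) = \<xi> n - f (\<xi> n) / f' (\<xi> n)"
    and left: "\<And>n. a < \<xi> n \<and> \<xi> n \<le> s"
  shows "\<xi> \<longlonglongrightarrow> s"
proof -
  have "incseq \<xi>" using step_ge_left left by (intro incseq_SucI) (simp add: step)
  \<comment> \<open>The first iterate provides a lower bound strictly above
    \<open>a\<close>.\<close>
  then have "\<And>n. \<xi> 0 \<le> \<xi> n" by (simp add: incseqD)
  moreover have "monoseq \<xi>" using \<open>incseq \<xi>\<close> by (rule incseq_imp_monoseq)
  ultimately show ?thesis using bounded_monotone_tendsto[of \<xi> "\<xi> 0" s] assms by blast
qed

lemma newton_antimono_left:
  assumes step: "\<And>n. \<xi> (Suc n) = \<xi> n - f (\<xi> n) / f' (\<xi> n)"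
    and start: "a < \<xi> 0" "\<xi> 0 \<le> s" and anti: "antimono_on {a<..s} f'"
  shows "range \<xi> \<subseteq> {a<..} \<and> \<xi> \<longlonglongrightarrow> s"
proof -
  have left: "a < \<xi> n \<and> \<xi> n \<le> s" for n
  proof (induction n)
    case (Suc n)
    then show ?case using step_ge_left[of "\<xi> n"] step_le_root[OF anti, of "\<xi> n"] by (simp add: step)
  qed (use start in simp)
  with tendsto_from_left[of \<xi>, OF step] show ?thesis by auto
qed

lemma newton_mono_right:
  assumes step: "\<And>n. \<xi> (Suc n) = \<xi> n - f (\<xi> n) / f' (\<xi> n)"
    and start: "a < \<xi> 0" and mono: "mono_on {s..} f'"
  shows "range \<xi> \<subseteq> {a<..} \<and> \<xi> \<longlonglongrightarrow> s"
proof -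
  \<comment> \<open>A step from the left of \<open>s\<close> moves right, possibly past
    \<open>s\<close>; a step from the right lands in \<open>{s..}\<close>.\<close>
  have gt: "a < \<xi> n" for n
  proof (induction n)
    case (Suc n)
    then show ?case
      using step_ge_left[of "\<xi> n"] step_ge_root[OF mono, of "\<xi> n"] root_gt
      by (cases "\<xi> n \<le> s") (auto simp: step)
  qed (use start in simp)
  have "\<xi> \<longlonglongrightarrow> s"
  proof (cases "\<forall>n. \<xi> n \<le> s")
    case True
    with tendsto_from_left[of \<xi>, OF step] gt show ?thesis by blast
  next
    case False
    then obtain N where N: "s \<le> \<xi> N" by (meson linear)
    \<comment> \<open>Dropping the iterates before \<open>N\<close> leaves a sequence confined to
      the interval from \<open>s\<close> to \<open>\<eta> 0\<close>.\<close>
    define \<eta> where "\<eta> n = \<xi> (n + N)" for n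
    have step': "\<eta> (Suc n) = \<eta> n - f (\<eta> n) / f' (\<eta> n)" for n by (simp add: \<eta>_def step)
    have ge: "s \<le> \<eta> n" for n
    proof (induction n)
      case (Suc n)
      then show ?case using step_ge_root[OF mono] by (simp add: step')
    qed (simp add: \<eta>_def N)
    have dec: "decseq \<eta>" using step_le_right ge by (intro decseq_SucI) (simp add: step')
    then have "\<And>n. \<eta> n \<le> \<eta> 0" by (simp add: decseqD)
    then have "\<eta> \<longlonglongrightarrow> s"
      using bounded_monotone_tendsto[of \<eta>, OF step' root_gt ge] decseq_imp_monoseq[OF dec] by blast
    then show ?thesis unfolding \<eta>_def by (rule LIMSEQ_offset)
  qed
  with gt show ?thesis by auto
qed

end

text \<open>A limit in \<open>ereal\<close> covers finite and infinite \<open>L\<close> alike: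
  either way \<open>f\<close> is eventually positive, and the intermediate value theorem
  applies.\<close>

lemma pos_limit_at_top_has_root:
  fixes f :: "real \<Rightarrow> real" and L :: ereal
  assumes cont: "continuous_on {a..} f" and neg: "f a < 0"
    and lim: "((\<lambda>x. ereal (f x)) \<longlongrightarrow> L) at_top" and lim_pos: "L > 0"
  shows "\<exists>s>a. f s = 0"
proof -
  have "eventually (\<lambda>x. ereal (f x) > 0 \<and> x > a) at_top"
    using order_tendstoD(1)[OF lim lim_pos] eventually_gt_at_top[of a] by (rule eventually_conj)
  then obtain b where b: "f b > 0" "b > a" by (auto dest!: eventually_happens)
  have "continuous_on {a..b} f" using cont by (rule continuous_on_subset) auto
  with IVT'[of f a 0 b] neg b obtain s where "a \<le> s" "f s = 0" by force
  moreover from this neg have "s \<noteq> a" by auto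
  ultimately show ?thesis by force
qed

theorem lemma3p11:
  fixes a :: real and f f' :: "real \<Rightarrow> real" and L :: ereal
  assumes cont: "continuous_on {a..} f"
    and deriv: "\<And>x. x \<in> {a<..} \<Longrightarrow> (f has_real_derivative f' x) (at x)"
    and neg: "f a < 0"
    and lim: "((\<lambda>x. ereal (f x)) \<longlongrightarrow> L) at_top" and lim_pos: "L > 0"
    and deriv_pos: "\<And>x. x \<in> {a<..} \<Longrightarrow> f' x > 0"
    and cond: "(mono_on {a<..} f' \<or> antimono_on {a<..} f') \<or>
      (\<exists>\<xi>in\<in>{a<..}. antimono_on {a<..\<xi>in} f' \<and> mono_on {\<xi>in..} f')"
  shows "(\<exists>!\<xi>s. \<xi>s \<in> {a<..} \<and> f \<xi>s = 0) \<and>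
    (\<forall>\<xi>s \<xi>. \<xi>s \<in> {a<..} \<and> f \<xi>s = 0 \<and> \<xi> 0 \<in> {a<..\<xi>s} \<and>
        (\<forall>n. \<xi> (Suc n) = \<xi> n - f (\<xi> n) / f' (\<xi> n)) \<longrightarrow>
      range \<xi> \<subseteq> {a<..} \<and> \<xi> \<longlonglongrightarrow> \<xi>s)"
proof -
  \<comment> \<open>This is quasiconvexity of \<open>f'\<close>, common to all cases. For a valley
    with bottom \<open>c\<close>, the end point \<open>u\<close> dominates when \<open>x\<close> is
    at most \<open>c\<close>, and \<open>v\<close> otherwise.\<close>
  have deriv_le_max: "f' x \<le> max (f' u) (f' v)" if "a < u" "u \<le> x" "x \<le> v" for u x v
  proof -
    have "f' x \<le> f' u \<or> f' x \<le> f' v"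
      using cond
    proof (elim disjE bexE conjE)
      fix c assume c: "antimono_on {a<..c} f'" "mono_on {c..} f'"
      then show ?thesis using that by (cases "x \<le> c") (auto simp: monotone_on_def)
    qed (use that in \<open>auto simp: monotone_on_def\<close>)
    then show ?thesis by auto
  qed
  \<comment> \<open>Kept general in the root: it serves the root found by the intermediate value
    theorem and the arbitrary root \<open>t\<close> of the convergence claim.\<close>
  have newton: "newton_root a s f f'" if "a < s" "f s = 0" for s
    using deriv deriv_pos deriv_le_max that by unfold_locales auto
  obtain s where s: "a < s" "f s = 0"
    using pos_limit_at_top_has_root[OF cont neg lim lim_pos] by blast
  have "\<exists>!s. s \<in> {a<..} \<and> f s = 0"
    using s newton_root.root_unique[OF newton[OF s]] by auto
  moreover have "range \<xi> \<subseteq> {a<..} \<and> \<xi> \<longlonglongrightarrow> t"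
    if t: "a < t" "f t = 0" and start: "a < \<xi> 0" "\<xi> 0 \<le> t"
      and step: "\<And>n. \<xi> (Suc n) = \<xi> n - f (\<xi> n) / f' (\<xi> n)" for t \<xi>
  proof -
    interpret newton_root a t f f' using newton[OF t] .
    have "antimono_on {a<..t} f' \<or> mono_on {t..} f'"
      using cond
    proof (elim disjE bexE conjE)
      fix c assume c: "antimono_on {a<..c} f'" "mono_on {c..} f'"
      show ?thesis
      \<comment> \<open>The position of the root relative to the valley bottom decides which branch
        contains the whole side of \<open>t\<close> that is needed.\<close>
      proof (cases "t \<le> c")
        case True
        then have "antimono_on {a<..t} f'" by (intro monotone_on_subset[OF c(1)]) auto
        then show ?thesis ..
      next
        case False
        then have "mono_on {t..} f'" by (intro monotone_on_subset[OF c(2)]) auto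
        then show ?thesis ..
      qed
    qed (use t(1) in \<open>auto simp: monotone_on_def\<close>)
    then show ?thesis
      using newton_antimono_left[of \<xi>, OF step start] newton_mono_right[of \<xi>, OF step start(1)] by blast
  qed
  ultimately show ?thesis by auto
qed

end
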